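(* Let $d\ge2$, let $X_1,\ldots,X_d$ and $Y$ be sequence classes with $Y$ being $0$-invariant, let $1\le m\le d$, let $E_1,\ldots,E_d,F$ be Banach spaces and let $a^m\in E_m$. If $A\in\mathcal{L}^{\mathbb{N}^d}_{X_1,\ldots,X_d;Y}(E_1,\ldots,E_d;F)$, then $$A_{a^m}\in\mathcal{L}^{\mathbb{N}^{d-1}}_{X_1,[\stackrel{m}{\ldots}],X_d;Y}(E_1,[\stackrel{m}{\ldots}],E_d;F)\quad\text{and}\quad\|A_{a^m}\|_{\mathbb{N}^{d-1};X_1,[\stackrel{m}{\ldots}],X_d;Y}\le\|A\|_{\mathbb{N}^d;X_1,\ldots,X_d;Y}\cdot\|a^m\|.$$
   Context: All Banach spaces are over $\mathbb{K}=\mathbb{R}$ or $\mathbb{C}$; $\mathcal{L}(E_1,\ldots,E_d;F)$ is the Banach space of continuous $d$-linear operators from $E_1\times\cdots\times E_d$ to $F$ with the usual operator norm. The symbol $[\stackrel{m}{\ldots}]$ means that the $m$-th item of the list is omitted. For $A\in\mathcal{L}(E_1,\ldots,E_d;F)$ and $a^m\in E_m$, $A_{a^m}\in\mathcal{L}(E_1,[\stackrel{m}{\ldots}],E_d;F)$ is the $(d-1)$-linear operator obtained from $A$ by fixing its $m$-th variable equal to $a^m$. A sequence class is a rule $X$ assigning to each Banach space $E$ a Banach space $X(E)$ of $E$-valued sequences (coordinatewise operations) such that $c_{00}(E)\subset X(E)\subset\ell_\infty(E)$ with $\|x\|_{\ell_\infty(E)}\le\|x\|_{X(E)}$ for $x\in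 X(E)$, and $\|e_j\|_{X(\mathbb{K})}=1$ for every $j$ ($c_{00}(E)$: eventually null sequences; $\ell_\infty(E)$: bounded sequences with the sup norm; $e_j$: canonical scalar unit sequences). $X$ is $0$-invariant if for every Banach space $E$ and every $E$-valued sequence $(x_j)_j$: $(x_j)_j\in X(E)$ if and only if $(x_j^0)_j\in X(E)$, and in this case $\|(x_j)_j\|_{X(E)}=\|(x_j^0)_j\|_{X(E)}$; here $x_j^0$ is the $j$-th nonzero coordinate of $(x_j)_j$ if it exists, and $0$ otherwise. A bijection $\sigma:\mathbb{N}\to\mathbb{N}^d$, $\sigma(n)=(j_n^1,\ldots,j_n^d)$, is fixed. $\mathcal{L}^{\mathbb{N}^d}_{X_1,\ldots,X_d;Y}(E_1,\ldots,E_d;F)$ is the set of $A\in\mathcal{L}(E_1,\ldots,E_d;F)$ such that $(A(x^1_{j_n^1},\ldots,x^d_{j_n^d}))_{n=1}^\infty\in Y(F)$ whenever $(x_j^r)_j\in X_r(E_r)$, $r=1,\ldots,d$; the norm $\|A\|_{\mathbb{N}^d;X_1,\ldots,X_d;Y}$ is the operator norm of the induced continuous $d$-linear operator $X_1(E_1)\times\cdots\times X_d(E_d)\to Y(F)$. For the given $m$, let $n_1<n_2<\cdots$ be the increasing enumeration of $\{n\in\mathbb{N}:j_n^m=1\}$. Then $k\mapsto(j^1_{n_k},[\stackrel{m}{\ldots}],j^d_{n_k})$ is a bijection $\mathbb{N}\to\mathbb{N}^{d-1}$, and $\mathbb{N}^{d-1}$ is enumerated by means of this bijection: $\mathcal{L}^{\mathbb{N}^{d-1}}_{X_1,[\stackrel{m}{\ldots}],X_d;Y}(E_1,[\stackrel{m}{\ldots}],E_d;F)$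 is the set of $B\in\mathcal{L}(E_1,[\stackrel{m}{\ldots}],E_d;F)$ such that $(B(x^1_{j^1_{n_k}},[\stackrel{m}{\ldots}],x^d_{j^d_{n_k}}))_{k=1}^\infty\in Y(F)$ whenever $(x_j^r)_j\in X_r(E_r)$, $r\ne m$; the norm $\|B\|_{\mathbb{N}^{d-1};X_1,[\stackrel{m}{\ldots}],X_d;Y}$ is the operator norm of the induced continuous $(d-1)$-linear operator from the product of the $X_r(E_r)$, $r\neq m$, into $Y(F)$.
   Formalization: The norm inequality is proved only when the sequence (a^m,0,0,…) has norm ‖a^m‖ in X_m(E_m); without this it can fail (e.g. X_m(E) = ℓ_∞(E) with doubled norm for E ≠ K). The membership claim is unconditional, as stated. *)

theory Defs
  imports
    "HOL-Analysis.Abstract_Metric_Spaces"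
    "HOL-Analysis.Function_Topology"
    "HOL-Algebra.Module"
    "HOL-Library.Infinite_Set"
    "HOL-Library.Extended_Nonnegative_Real"
begin

section \<open>Banach spaces with explicit carriers\<close>

text \<open>
  Sequence classes quantify over all Banach spaces, so a Banach space is a value (a
  module record with a norm), not a type of class banach. The scalar field is a type of
  class real_normed_field and banach; by the Gelfand--Mazur theorem these are, up to isometric
  isomorphism, exactly the real and the complex numbers.
\<close>

record ('k, 'a) normed_vs = "('k, 'a) module" +
  vnorm :: "'a \<Rightarrow> real"

definition scalar_ring :: "'k::field ring"
  where "scalar_ring = \<lparr>carrier = UNIV, mult = (*), one = 1, zero = 0, add = (+)\<rparr>"

text \<open>Metric_space requires its distance to be nonnegative and symmetric on the whole type.\<close>

definition vdist :: "('k, 'a) normed_vs \<Rightarrow> 'a \<Rightarrow> 'a \<Rightarrow> real"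
  where "vdist E x y =
    (if x \<in> carrier E \<and> y \<in> carrier E then vnorm E (x \<ominus>\<^bsub>E\<^esub> y) else 0)"

definition banach_space :: "('k::{real_normed_field,banach}, 'a) normed_vs \<Rightarrow> bool"
  where "banach_space E \<longleftrightarrow>
    module scalar_ring E \<and>
    (\<forall>x\<in>carrier E. 0 \<le> vnorm E x \<and> (vnorm E x = 0 \<longleftrightarrow> x = \<zero>\<^bsub>E\<^esub>)) \<and>
    (\<forall>c. \<forall>x\<in>carrier E. vnorm E (c \<odot>\<^bsub>E\<^esub> x) = norm c * vnorm E x) \<and>
    (\<forall>x\<in>carrier E. \<forall>y\<in>carrier E. vnorm E (x \<oplus>\<^bsub>E\<^esub> y) \<le> vnorm E x + vnorm E y) \<and>
    Metric_space.mcomplete (carrier E) (vdist E)"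

definition norm_topology :: "('k, 'a) normed_vs \<Rightarrow> 'a topology"
  where "norm_topology E = Metric_space.mtopology (carrier E) (vdist E)"

text \<open>
  All Banach spaces under consideration have their carrier inside the type 'k + 'u, where
  'u is arbitrary: the summand 'k makes the scalar field itself one of these spaces,
  and any given family of Banach spaces fits into 'k + 'u for a large enough 'u.
\<close>

definition scalar_space :: "('k::{real_normed_field,banach}, 'k + 'u) normed_vs"
  where "scalar_space =
    \<lparr>carrier = range Inl,
     mult = (\<lambda>x y. Inl (projl x * projl y)), one = Inl 1,
     zero = Inl 0, add = (\<lambda>x y. Inl (projl x + projl y)),
     smult = (\<lambda>c x. Inl (c * projl x)),
     vnorm = (\<lambda>x. norm (projl x))\<rparr>"


section \<open>Sequence classes\<close>

text \<open>Sequences are indexed from 0, so the first coordinate has index 0.\<close>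

type_synonym ('k, 'u) seq_rule =
  "('k, 'k + 'u) normed_vs \<Rightarrow> ('k, nat \<Rightarrow> 'k + 'u) normed_vs"

definition c00 :: "('k, 'a) normed_vs \<Rightarrow> (nat \<Rightarrow> 'a) set"
  where "c00 E = {x. (\<forall>j. x j \<in> carrier E) \<and> (\<forall>\<^sub>F j in sequentially. x j = \<zero>\<^bsub>E\<^esub>)}"

definition linfty :: "('k, 'a) normed_vs \<Rightarrow> (nat \<Rightarrow> 'a) set"
  where "linfty E = {x. (\<forall>j. x j \<in> carrier E) \<and> bdd_above (range (\<lambda>j. vnorm E (x j)))}"

definition linfty_norm :: "('k, 'a) normed_vs \<Rightarrow> (nat \<Rightarrow> 'a) \<Rightarrow> real"
  where "linfty_norm E x = (SUP j. vnorm E (x j))"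

text \<open>The sequence with v in position j and 0 elsewhere.\<close>

definition single_seq :: "('k, 'a) normed_vs \<Rightarrow> nat \<Rightarrow> 'a \<Rightarrow> nat \<Rightarrow> 'a"
  where "single_seq E j v = (\<lambda>i. if i = j then v else \<zero>\<^bsub>E\<^esub>)"

definition coordinatewise :: "('k, 'a) normed_vs \<Rightarrow> ('k, nat \<Rightarrow> 'a) normed_vs \<Rightarrow> bool"
  where "coordinatewise E S \<longleftrightarrow>
    \<zero>\<^bsub>S\<^esub> = (\<lambda>j. \<zero>\<^bsub>E\<^esub>) \<and>
    (\<forall>x\<in>carrier S. \<forall>y\<in>carrier S. x \<oplus>\<^bsub>S\<^esub> y = (\<lambda>j. x j \<oplus>\<^bsub>E\<^esub> y j)) \<and>
    (\<forall>c. \<forall>x\<in>carrier S. c \<odot>\<^bsub>S\<^esub> x = (\<lambda>j. c \<odot>\<^bsub>E\<^esub> x j))"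

definition sequence_class :: "('k::{real_normed_field,banach}, 'u) seq_rule \<Rightarrow> bool"
  where "sequence_class X \<longleftrightarrow>
    (\<forall>E. banach_space E \<longrightarrow>
      banach_space (X E) \<and> coordinatewise E (X E) \<and>
      c00 E \<subseteq> carrier (X E) \<and> carrier (X E) \<subseteq> linfty E \<and>
      (\<forall>x\<in>carrier (X E). linfty_norm E x \<le> vnorm (X E) x)) \<and>
    (\<forall>j. vnorm (X scalar_space) (single_seq scalar_space j (Inl 1)) = 1)"

definition nonzero_part :: "('k, 'a) normed_vs \<Rightarrow> (nat \<Rightarrow> 'a) \<Rightarrow> nat \<Rightarrow> 'a"
  where "nonzero_part E x = (let N = {i. x i \<noteq> \<zero>\<^bsub>E\<^esub>} in
    (\<lambda>j. if infinite N \<or> j < card N then x (enumerate N j) else \<zero>\<^bsub>E\<^esub>))"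

definition zero_invariant :: "('k::{real_normed_field,banach}, 'u) seq_rule \<Rightarrow> bool"
  where "zero_invariant X \<longleftrightarrow>
    (\<forall>E. banach_space E \<longrightarrow> (\<forall>x. (\<forall>j. x j \<in> carrier E) \<longrightarrow>
      (x \<in> carrier (X E) \<longleftrightarrow> nonzero_part E x \<in> carrier (X E)) \<and>
      (x \<in> carrier (X E) \<longrightarrow> vnorm (X E) x = vnorm (X E) (nonzero_part E x))))"


section \<open>Multilinear operators\<close>

text \<open>
  The factors are indexed by a set I of natural numbers; a tuple is an extensional
  function on I. The d-linear case is I = {1..d}, and omitting the m-th variable
  means passing to I - {m}.
\<close>

abbreviation tuples :: "nat set \<Rightarrow> (nat \<Rightarrow> ('k, 'a) normed_vs) \<Rightarrow> (nat \<Rightarrow> 'a) set"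
  where "tuples I E \<equiv> (\<Pi>\<^sub>E i\<in>I. carrier (E i))"

definition continuous_multilinear ::
    "nat set \<Rightarrow> (nat \<Rightarrow> ('k, 'a) normed_vs) \<Rightarrow> ('k, 'b) normed_vs \<Rightarrow> ((nat \<Rightarrow> 'a) \<Rightarrow> 'b) set"
  where "continuous_multilinear I E F = {A \<in> tuples I E \<rightarrow>\<^sub>E carrier F.
    (\<forall>x\<in>tuples I E. \<forall>i\<in>I. \<forall>u\<in>carrier (E i). \<forall>v\<in>carrier (E i).
       A (x(i := u \<oplus>\<^bsub>E i\<^esub> v)) = A (x(i := u)) \<oplus>\<^bsub>F\<^esub> A (x(i := v))) \<and>
    (\<forall>x\<in>tuples I E. \<forall>i\<in>I. \<forall>u\<in>carrier (E i). \<forall>c.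
       A (x(i := c \<odot>\<^bsub>E i\<^esub> u)) = c \<odot>\<^bsub>F\<^esub> A (x(i := u))) \<and>
    continuous_map (product_topology (\<lambda>i. norm_topology (E i)) I) (norm_topology F) A}"

definition fix_var ::
    "nat set \<Rightarrow> (nat \<Rightarrow> ('k, 'a) normed_vs) \<Rightarrow> nat \<Rightarrow> 'a \<Rightarrow> ((nat \<Rightarrow> 'a) \<Rightarrow> 'b) \<Rightarrow> (nat \<Rightarrow> 'a) \<Rightarrow> 'b"
  where "fix_var I E m a A = (\<lambda>x\<in>tuples (I - {m}) E. A (x(m := a)))"

text \<open>
  The map s enumerates the index tuples (functions on I); x r is the sequence
  in the r-th variable.
\<close>

definition induced ::
    "nat set \<Rightarrow> (nat \<Rightarrow> nat \<Rightarrow> nat) \<Rightarrow> ((nat \<Rightarrow> 'a) \<Rightarrow> 'b) \<Rightarrow> (nat \<Rightarrow> nat \<Rightarrow> 'a) \<Rightarrow> nat \<Rightarrow> 'b"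
  where "induced I s A x = (\<lambda>n. A (\<lambda>r\<in>I. x r (s n r)))"

definition summing_ops ::
    "nat set \<Rightarrow> (nat \<Rightarrow> nat \<Rightarrow> nat) \<Rightarrow> (nat \<Rightarrow> ('k, 'u) seq_rule) \<Rightarrow> ('k, 'u) seq_rule \<Rightarrow>
     (nat \<Rightarrow> ('k, 'k + 'u) normed_vs) \<Rightarrow> ('k, 'k + 'u) normed_vs \<Rightarrow>
     ((nat \<Rightarrow> 'k + 'u) \<Rightarrow> 'k + 'u) set"
  where "summing_ops I s X Y E F = {A \<in> continuous_multilinear I E F.
    \<forall>x \<in> tuples I (\<lambda>r. X r (E r)). induced I s A x \<in> carrier (Y F)}"

text \<open>
  The operator norm of the induced multilinear operator, as a supremum over the product
  of the closed unit balls. It is taken in the extended nonnegative reals so that the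
  supremum makes sense without a prior boundedness proof.
\<close>

definition summing_norm ::
    "nat set \<Rightarrow> (nat \<Rightarrow> nat \<Rightarrow> nat) \<Rightarrow> (nat \<Rightarrow> ('k, 'u) seq_rule) \<Rightarrow> ('k, 'u) seq_rule \<Rightarrow>
     (nat \<Rightarrow> ('k, 'k + 'u) normed_vs) \<Rightarrow> ('k, 'k + 'u) normed_vs \<Rightarrow>
     ((nat \<Rightarrow> 'k + 'u) \<Rightarrow> 'k + 'u) \<Rightarrow> ennreal"
  where "summing_norm I s X Y E F A =
    (SUP x \<in> {x \<in> tuples I (\<lambda>r. X r (E r)). \<forall>r\<in>I. vnorm (X r (E r)) (x r) \<le> 1}.
       ennreal (vnorm (Y F) (induced I s A x)))"

text \<open>
  The enumeration of the tuples over I - {m} obtained from s by running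
  through the positions n at which the m-th index is the first one (that is, 0).
\<close>

definition omit_enum :: "nat set \<Rightarrow> nat \<Rightarrow> (nat \<Rightarrow> nat \<Rightarrow> nat) \<Rightarrow> nat \<Rightarrow> nat \<Rightarrow> nat"
  where "omit_enum I m s = (\<lambda>k. restrict (s (enumerate {n. s n m = 0} k)) (I - {m}))"

end

theory Submission
  imports Defs
begin

text \<open>
  Insert the sequence $(a, 0, 0, \ldots)$ into the $m$-th variable of $A$. By multilinearity,
  the induced sequence vanishes at every position $n$ whose $m$-th index is not the first one,
  and at the remaining positions it runs through the induced sequence of $A_a$. So both have
  the same nonzero part, and 0-invariance of $Y$ gives them the same membership and norm.
  The norm estimate follows by rescaling $(a, 0, 0, \ldots)$ into the unit ball.
\<close>

section \<open>Increasing enumerations and nonzero parts\<close>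

text \<open>A strictly increasing map sends least elements to least elements, so peeling off minima
  commutes with it. The bound on \<open>j\<close> matters: once \<open>T\<close> is exhausted,
  \<open>enumerate\<close> returns the unspecified least element of the empty set.\<close>

lemma enumerate_strict_mono_image:
  fixes e :: "nat \<Rightarrow> nat"
  assumes e: "strict_mono e" and "infinite T \<or> j < card T"
  shows "enumerate (e ` T) j = e (enumerate T j)"
  using assms(2)
proof (induction j arbitrary: T)
  case 0
  then have "T \<noteq> {}" by auto
  then show ?case
    using Least_mono[of e T] e
    by (metis LeastI_ex Least_le enumerate_0 ex_in_conv strict_mono_mono)
next
  case (Suc j)
  then have ne: "T \<noteq> {}" by auto
  let ?l = "LEAST n. n \<in> T"
  have l: "?l \<in> T" using ne by (metis LeastI ex_in_conv)
  have least: "(LEAST n. n \<in> e ` T) = e ?l"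
    using Least_mono[of e T] e l by (metis Least_le strict_mono_mono)
  have "e ` T - {e ?l} = e ` (T - {?l})"
    using image_set_diff[OF strict_mono_imp_inj_on[OF e], of T "{?l}"] by simp
  moreover have "infinite (T - {?l}) \<or> j < card (T - {?l})"
    using Suc.prems l by auto
  ultimately show ?case
    using Suc.IH least by (simp add: enumerate_Suc' enumerate_0)
qed

text \<open>Restricting to the positions in \<open>N\<close> deletes only zeros and keeps the order
  of the remaining terms.\<close>

lemma nonzero_part_compose_enumerate:
  assumes "infinite N" and zero: "\<And>n. n \<notin> N \<Longrightarrow> y n = \<zero>\<^bsub>F\<^esub>"
  shows "nonzero_part F (\<lambda>k. y (enumerate N k)) = nonzero_part F y"
proof -
  let ?e = "enumerate N"
  let ?T = "{k. y (?e k) \<noteq> \<zero>\<^bsub>F\<^esub>}"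
  have e: "strict_mono ?e"
    using assms(1) by (rule strict_mono_enumerate)
  have range: "range ?e = N"
    using assms(1) by (rule range_enumerate)
  have inj: "inj_on ?e ?T"
    using strict_mono_imp_inj_on[OF e] by (rule inj_on_subset) (rule subset_UNIV)
  have image: "{i. y i \<noteq> \<zero>\<^bsub>F\<^esub>} = ?e ` ?T"
    proof -
    have "?e ` ?T = {i. y i \<noteq> \<zero>\<^bsub>F\<^esub>} \<inter> range ?e"
      by auto
    then show ?thesis
      using zero range by blast
  qed
  \<comment> \<open>Injectivity gives \<open>?T\<close> and its image the same cardinality, so the
    guards in the two nonzero parts agree, and the guard is exactly the proviso of the enumeration
    lemma.\<close>
  show ?thesis
    unfolding nonzero_part_def Let_def image
    using enumerate_strict_mono_image[OF e, of ?T]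
    by (auto simp: fun_eq_iff card_image[OF inj] finite_image_iff[OF inj])
qed

section \<open>Metric and linear structure of Banach spaces\<close>

text \<open>\<open>banach_space\<close> asserts completeness through \<open>mcomplete\<close>, which
  does not contain the metric axioms; they come from the norm axioms. They are needed to identify
  the points of \<open>norm_topology\<close>.\<close>

lemma Metric_space_vdist:
  fixes E :: "('k::{real_normed_field,banach}, 'a) normed_vs"
  assumes "banach_space E"
  shows "Metric_space (carrier E) (vdist E)"
proof -
  interpret module scalar_ring E
    using assms by (simp add: banach_space_def)
  have scalar[simp]: "carrier scalar_ring = UNIV" "\<one>\<^bsub>scalar_ring\<^esub> = 1"
    "add scalar_ring = (+)" "\<zero>\<^bsub>scalar_ring\<^esub> = 0"
    by (simp_all add: scalar_ring_def)
  have pos: "0 \<le> vnorm E x" "vnorm E x = 0 \<longleftrightarrow> x = \<zero>\<^bsub>E\<^esub>"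
    and smult: "vnorm E (c \<odot>\<^bsub>E\<^esub> x) = norm c * vnorm E x"
    if "x \<in> carrier E" for x c
    using assms that by (auto simp: banach_space_def)
  have tri: "vnorm E (x \<oplus>\<^bsub>E\<^esub> y) \<le> vnorm E x + vnorm E y"
    if "x \<in> carrier E" "y \<in> carrier E" for x y
    using assms that by (auto simp: banach_space_def)
  \<comment> \<open>Symmetry of the distance rests on this. The module law speaks of the inverse of
    the ring unit, which is identified with the number -1 before homogeneity applies;
    \<open>del: scalar\<close> keeps the ring notation until then.\<close>
  have neg: "vnorm E (\<ominus>\<^bsub>E\<^esub> x) = vnorm E x" if x: "x \<in> carrier E" for x
  proof -
    have "\<ominus>\<^bsub>scalar_ring\<^esub> \<one>\<^bsub>scalar_ring\<^esub> \<odot>\<^bsub>E\<^esub> x = \<ominus>\<^bsub>E\<^esub> x"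
      using x by (simp del: scalar add: smult_l_minus)
    moreover have "\<ominus>\<^bsub>scalar_ring\<^esub> \<one>\<^bsub>scalar_ring\<^esub> = (-1 :: 'k)"
      using R.minus_equality[of "-1" 1] by simp
    ultimately have "\<ominus>\<^bsub>E\<^esub> x = (-1) \<odot>\<^bsub>E\<^esub> x"
      by simp
    then show ?thesis
      using smult[OF x, of "-1"] by simp
  qed
  show ?thesis
  proof
    fix x y
    show "0 \<le> vdist E x y"
      by (simp add: vdist_def pos)
    have "vnorm E (x \<ominus>\<^bsub>E\<^esub> y) = vnorm E (y \<ominus>\<^bsub>E\<^esub> x)"
      if "x \<in> carrier E" "y \<in> carrier E"
      using neg[of "x \<ominus>\<^bsub>E\<^esub> y"] that
      by (simp add: M.minus_eq M.minus_add M.a_comm)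
    then show "vdist E x y = vdist E y x"
      by (simp add: vdist_def)
  next
    fix x y
    assume xy: "x \<in> carrier E" "y \<in> carrier E"
    then have "x = (x \<ominus>\<^bsub>E\<^esub> y) \<oplus>\<^bsub>E\<^esub> y"
      by (simp add: M.minus_eq M.a_assoc M.l_neg)
    then have "x \<ominus>\<^bsub>E\<^esub> y = \<zero>\<^bsub>E\<^esub> \<longleftrightarrow> x = y"
      using xy by (metis M.l_zero M.minus_eq M.r_neg)
    then show "vdist E x y = 0 \<longleftrightarrow> x = y"
      using xy by (simp add: vdist_def pos)
  next
    fix x y z
    assume xyz: "x \<in> carrier E" "y \<in> carrier E" "z \<in> carrier E"
    have "x \<ominus>\<^bsub>E\<^esub> z = (x \<ominus>\<^bsub>E\<^esub> y) \<oplus>\<^bsub>E\<^esub> (y \<ominus>\<^bsub>E\<^esub> z)"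
      using xyz by (simp add: M.minus_eq M.a_assoc M.r_neg1)
    then show "vdist E x z \<le> vdist E x y + vdist E y z"
      using xyz tri[of "x \<ominus>\<^bsub>E\<^esub> y" "y \<ominus>\<^bsub>E\<^esub> z"] by (simp add: vdist_def)
  qed
qed

lemma topspace_norm_topology:
  "banach_space E \<Longrightarrow> topspace (norm_topology E) = carrier E"
  unfolding norm_topology_def
  by (rule Metric_space.topspace_mtopology[OF Metric_space_vdist])

lemma banach_space_smult_zero:
  assumes "banach_space E" and "x \<in> carrier E"
  shows "0 \<odot>\<^bsub>E\<^esub> x = \<zero>\<^bsub>E\<^esub>"
proof -
  interpret module scalar_ring E
    using assms by (simp add: banach_space_def)
  show ?thesis
    using smult_l_null[OF assms(2)] by (simp add: scalar_ring_def)
qed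

lemma banach_space_smult_closed:
  assumes "banach_space E" and "x \<in> carrier E"
  shows "c \<odot>\<^bsub>E\<^esub> x \<in> carrier E"
proof -
  interpret module scalar_ring E
    using assms by (simp add: banach_space_def)
  show ?thesis
    using smult_closed[OF _ assms(2), of c] by (simp add: scalar_ring_def)
qed

lemma banach_space_zero_closed:
  assumes "banach_space E"
  shows "\<zero>\<^bsub>E\<^esub> \<in> carrier E"
proof -
  interpret module scalar_ring E
    using assms by (simp add: banach_space_def)
  show ?thesis by simp
qed

section \<open>Multilinear operators and fixing a variable\<close>

text \<open>Write the zero argument as 0 times itself and pull the scalar 0 out by
  homogeneity.\<close>

lemma continuous_multilinear_zero:
  assumes A: "A \<in> continuous_multilinear I E F" and "banach_space F"
    and "banach_space (E i)" and x: "x \<in> tuples I E" and i: "i \<in> I" and "x i = \<zero>\<^bsub>E i\<^esub>"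
  shows "A x = \<zero>\<^bsub>F\<^esub>"
proof -
  have zero: "\<zero>\<^bsub>E i\<^esub> \<in> carrier (E i)"
    using assms(3) by (rule banach_space_zero_closed)
  have x_eq: "x(i := \<zero>\<^bsub>E i\<^esub>) = x"
    using assms(6) by auto
  have "A (x(i := 0 \<odot>\<^bsub>E i\<^esub> \<zero>\<^bsub>E i\<^esub>)) = 0 \<odot>\<^bsub>F\<^esub> A (x(i := \<zero>\<^bsub>E i\<^esub>))"
    using A x i zero by (simp add: continuous_multilinear_def)
  moreover have "A x \<in> carrier F"
    using A x by (auto simp: continuous_multilinear_def)
  ultimately show ?thesis
    using assms(2,3) zero by (simp add: banach_space_smult_zero x_eq)
qed

lemma fun_upd_tuples:
  assumes "m \<in> I" and "x \<in> tuples (I - {m}) E" and "a \<in> carrier (E m)"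
  shows "x(m := a) \<in> tuples I E"
  using PiE_fun_upd[OF assms(3,2)] assms(1) by (simp add: insert_absorb)

text \<open>On tuples the operator is \<open>A\<close> composed with the insertion of
  \<open>a\<close>, which is continuous because each coordinate is either constant or a
  projection.\<close>

lemma fix_var_continuous_multilinear:
  assumes A: "A \<in> continuous_multilinear I E F" and m: "m \<in> I" and a: "a \<in> carrier (E m)"
    and E: "\<And>i. i \<in> I \<Longrightarrow> banach_space (E i)"
  shows "fix_var I E m a A \<in> continuous_multilinear (I - {m}) E F"
proof -
  let ?B = "fix_var I E m a A" and ?J = "I - {m}"
  let ?T = "\<lambda>J. product_topology (\<lambda>i. norm_topology (E i)) J"
  have upd: "x(m := a) \<in> tuples I E" if "x \<in> tuples ?J E" for x
    using m that a by (rule fun_upd_tuples)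
  have B: "?B x = A (x(m := a))" if "x \<in> tuples ?J E" for x
    using that by (simp add: fix_var_def)
  have upd': "x(i := u) \<in> tuples ?J E"
    if "x \<in> tuples ?J E" "i \<in> ?J" "u \<in> carrier (E i)" for x i u
    using PiE_fun_upd[OF that(3,1)] that(2) by (simp add: insert_absorb)
  \<comment> \<open>As \<open>i\<close> differs from \<open>m\<close>, the two updates commute;
    linearity of \<open>A\<close> can then be used at the base point
    \<open>x(m := a)\<close>.\<close>
  have Bupd: "?B (x(i := u)) = A (x(m := a, i := u))"
    if "x \<in> tuples ?J E" "i \<in> ?J" "u \<in> carrier (E i)" for x i u
    using B[OF upd'[OF that]] that(2) by (simp add: fun_upd_twist)
  have topspace: "topspace (?T J) = tuples J E" if "J \<subseteq> I" for J
    using that E by (auto simp: topspace_norm_topology intro!: PiE_cong)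
  have "continuous_map (?T ?J) (?T I) (\<lambda>x. x(m := a))"
    unfolding continuous_map_componentwise
  proof (intro conjI ballI)
    show "(\<lambda>x. x(m := a)) ` topspace (?T ?J) \<subseteq> extensional I"
      using upd topspace[of ?J] by (auto simp: PiE_def)
    fix i assume i: "i \<in> I"
    show "continuous_map (?T ?J) (norm_topology (E i)) (\<lambda>x. (x(m := a)) i)"
    proof (cases "i = m")
      case True
      then show ?thesis using a E[OF m] by (simp add: topspace_norm_topology)
    next
      case False
      then show ?thesis
        using i continuous_map_product_projection[of i ?J "\<lambda>i. norm_topology (E i)"] by simp
    qed
  qed
  moreover have "continuous_map (?T I) (norm_topology F) A"
    using A by (simp add: continuous_multilinear_def)
  ultimately have "continuous_map (?T ?J) (norm_topology F) (A \<circ> (\<lambda>x. x(m := a)))"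
    by (rule continuous_map_compose)
  \<comment> \<open>The composite and \<open>?B\<close> may differ outside the tuples, but
    continuity depends only on values on the topological space.\<close>
  then have "continuous_map (?T ?J) (norm_topology F) ?B"
  proof (rule continuous_map_eq)
    fix x assume "x \<in> topspace (?T ?J)"
    then show "(A \<circ> (\<lambda>x. x(m := a))) x = ?B x"
      by (simp only: topspace[OF Diff_subset] B o_def)
  qed
  moreover have "?B \<in> tuples ?J E \<rightarrow>\<^sub>E carrier F"
  proof -
    have "A \<in> tuples I E \<rightarrow>\<^sub>E carrier F"
      using A by (simp add: continuous_multilinear_def)
    from PiE_mem[OF this upd] show ?thesis
      by (simp add: fix_var_def)
  qed
  moreover have "?B (x(i := u \<oplus>\<^bsub>E i\<^esub> v)) = ?B (x(i := u)) \<oplus>\<^bsub>F\<^esub> ?B (x(i := v))"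
    if "x \<in> tuples ?J E" "i \<in> ?J" "u \<in> carrier (E i)" "v \<in> carrier (E i)" for x i u v
  proof -
    \<comment> \<open>Supplies closure under addition, so that \<open>Bupd\<close> also applies to
      the sum of \<open>u\<close> and \<open>v\<close>.\<close>
    interpret module scalar_ring "E i"
      using E that(2) by (simp add: banach_space_def)
    show ?thesis
      using A that upd[OF that(1)] by (simp add: Bupd continuous_multilinear_def)
  qed
  moreover have "?B (x(i := c \<odot>\<^bsub>E i\<^esub> u)) = c \<odot>\<^bsub>F\<^esub> ?B (x(i := u))"
    if "x \<in> tuples ?J E" "i \<in> ?J" "u \<in> carrier (E i)" for x i u c
    using A that upd[OF that(1)] banach_space_smult_closed[OF E that(3), of c]
    by (simp add: Bupd continuous_multilinear_def)
  ultimately show ?thesis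
    by (simp add: continuous_multilinear_def)
qed

section \<open>Positions whose m-th index is the first one\<close>

text \<open>With the m-th index held at 0, another index \<open>r\<close> still runs through all
  naturals: \<open>?f k\<close> has \<open>k\<close> at \<open>r\<close> and 0 elsewhere, and is
  injective in \<open>k\<close>.\<close>

lemma infinite_fiber:
  assumes \<sigma>: "bij_betw \<sigma> UNIV (I \<rightarrow>\<^sub>E (UNIV :: nat set))" and "m \<in> I" "r \<in> I" "r \<noteq> m"
  shows "infinite {n. \<sigma> n m = 0}"
proof
  let ?f = "\<lambda>k::nat. \<lambda>i\<in>I. if i = r then k else 0"
  assume "finite {n. \<sigma> n m = 0}"
  then have "finite (\<sigma> ` {n. \<sigma> n m = 0})" by simp
  moreover have "range ?f \<subseteq> \<sigma> ` {n. \<sigma> n m = 0}"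
  proof
    fix g assume "g \<in> range ?f"
    then obtain k where g: "g = ?f k" by auto
    then have "g \<in> range \<sigma>"
      using \<sigma> by (simp add: bij_betw_def)
    moreover have "g m = 0"
      using g assms(2,4) by simp
    ultimately show "g \<in> \<sigma> ` {n. \<sigma> n m = 0}"
      by blast
  qed
  ultimately have "finite (range ?f)" by (rule finite_subset[rotated])
  moreover have "inj ?f"
    using assms(3) by (auto simp: inj_def fun_eq_iff)
  ultimately show False
    using finite_imageD infinite_UNIV_nat by blast
qed

section \<open>Sequences in a sequence class\<close>

lemma single_seq_in_sequence_class:
  assumes "sequence_class X" and "banach_space E" and "a \<in> carrier E"
  shows "single_seq E j a \<in> carrier (X E)"
proof -
  have "\<forall>\<^sub>F i in sequentially. single_seq E j a i = \<zero>\<^bsub>E\<^esub>"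
    \<comment> \<open>Position \<open>j\<close> itself carries \<open>a\<close>, so the zeros are
      guaranteed from \<open>Suc j\<close> on.\<close>
    unfolding eventually_sequentially single_seq_def by (intro exI[of _ "Suc j"]) auto
  then have "single_seq E j a \<in> c00 E"
    using banach_space_zero_closed[OF assms(2)] assms(3)
    by (auto simp: c00_def single_seq_def)
  then show ?thesis
    using assms(1,2) by (auto simp: sequence_class_def)
qed

lemma sequence_class_carrier_closed:
  assumes "sequence_class X" and "banach_space E" and "x \<in> carrier (X E)"
  shows "x j \<in> carrier E"
  using assms by (auto simp: sequence_class_def linfty_def)

lemma sequence_tuple_coordinates:
  assumes "\<And>r. r \<in> I \<Longrightarrow> sequence_class (X r)" and "\<And>r. r \<in> I \<Longrightarrow> banach_space (E r)"
    and "x \<in> tuples I (\<lambda>r. X r (E r))"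
  shows "(\<lambda>r\<in>I. x r (s r)) \<in> tuples I E"
proof (rule restrict_PiE_iff[THEN iffD2, rule_format])
  fix r assume r: "r \<in> I"
  show "x r (s r) \<in> carrier (E r)"
    using PiE_mem[OF assms(3) r] by (rule sequence_class_carrier_closed[OF assms(1,2)[OF r]])
qed

text \<open>Transfers closure and homogeneity from the Banach space \<open>X E\<close> to the
  literal coordinatewise multiple, the form in which scaled sequences enter
  \<open>induced\<close>.\<close>

lemma sequence_class_smult:
  assumes "sequence_class X" and "banach_space E" and x: "x \<in> carrier (X E)"
  shows "(\<lambda>j. c \<odot>\<^bsub>E\<^esub> x j) \<in> carrier (X E)"
    and "vnorm (X E) (\<lambda>j. c \<odot>\<^bsub>E\<^esub> x j) = norm c * vnorm (X E) x"
proof -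
  have banach: "banach_space (X E)"
    and eq: "c \<odot>\<^bsub>X E\<^esub> x = (\<lambda>j. c \<odot>\<^bsub>E\<^esub> x j)"
    using assms by (auto simp: sequence_class_def coordinatewise_def)
  show "(\<lambda>j. c \<odot>\<^bsub>E\<^esub> x j) \<in> carrier (X E)"
    using banach_space_smult_closed[OF banach x, of c] by (simp add: eq)
  show "vnorm (X E) (\<lambda>j. c \<odot>\<^bsub>E\<^esub> x j) = norm c * vnorm (X E) x"
    using banach x by (simp add: banach_space_def flip: eq)
qed

lemma sequence_class_vnorm_zero:
  assumes "sequence_class X" and "banach_space E"
  shows "vnorm (X E) (\<lambda>j. \<zero>\<^bsub>E\<^esub>) = 0"
proof -
  have banach: "banach_space (X E)" and zero: "\<zero>\<^bsub>X E\<^esub> = (\<lambda>j. \<zero>\<^bsub>E\<^esub>)"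
    using assms by (auto simp: sequence_class_def coordinatewise_def)
  then show ?thesis
    using banach_space_zero_closed[OF banach] unfolding banach_space_def zero[symmetric] by blast
qed

section \<open>Induced sequences\<close>

text \<open>\<open>omit_enum\<close> visits exactly the positions with m-th index 0, and there the
  sequence (a, 0, 0, ...) puts \<open>a\<close> into the m-th slot of \<open>A\<close>.\<close>

lemma induced_fix_var:
  assumes "m \<in> I" and X: "\<And>r. r \<in> I \<Longrightarrow> sequence_class (X r)"
    and E: "\<And>r. r \<in> I \<Longrightarrow> banach_space (E r)"
    and x: "x \<in> tuples (I - {m}) (\<lambda>r. X r (E r))"
    and N: "infinite {n. \<sigma> n m = 0}"
  shows "induced (I - {m}) (omit_enum I m \<sigma>) (fix_var I E m a A) x =
    (\<lambda>k. induced I \<sigma> A (x(m := single_seq (E m) 0 a)) (enumerate {n. \<sigma> n m = 0} k))"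
proof
  fix k
  let ?n = "enumerate {n. \<sigma> n m = 0} k"
  have n: "\<sigma> ?n m = 0"
    using enumerate_in_set[OF N] by simp
  have "(\<lambda>r\<in>I - {m}. x r (omit_enum I m \<sigma> k r)) = (\<lambda>r\<in>I - {m}. x r (\<sigma> ?n r))"
    by (auto simp: omit_enum_def)
  \<comment> \<open>\<open>fix_var\<close> has its intended value only on tuples, so membership must
    be known before it is unfolded.\<close>
  moreover have "(\<lambda>r\<in>I - {m}. x r (\<sigma> ?n r)) \<in> tuples (I - {m}) E"
    using X E x by (intro sequence_tuple_coordinates[where X = X]) auto
  moreover have "(\<lambda>r\<in>I - {m}. x r (\<sigma> ?n r))(m := a) =
      (\<lambda>r\<in>I. (x(m := single_seq (E m) 0 a)) r (\<sigma> ?n r))"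
    using \<open>m \<in> I\<close> n by (auto simp: single_seq_def fun_eq_iff)
  ultimately show "induced (I - {m}) (omit_enum I m \<sigma>) (fix_var I E m a A) x k =
      induced I \<sigma> A (x(m := single_seq (E m) 0 a)) ?n"
    unfolding induced_def fix_var_def by simp
qed

lemma induced_eq_zero:
  assumes A: "A \<in> continuous_multilinear I E F" and F: "banach_space F"
    and X: "\<And>r. r \<in> I \<Longrightarrow> sequence_class (X r)"
    and E: "\<And>r. r \<in> I \<Longrightarrow> banach_space (E r)"
    and x: "x \<in> tuples I (\<lambda>r. X r (E r))" and "m \<in> I" and "x m (\<sigma> n m) = \<zero>\<^bsub>E m\<^esub>"
  shows "induced I \<sigma> A x n = \<zero>\<^bsub>F\<^esub>"
  unfolding induced_def
  using sequence_tuple_coordinates[OF X E x, of "\<sigma> n"] assms(6,7)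
  by (intro continuous_multilinear_zero[OF A F E[OF assms(6)]]) auto

text \<open>Only one variable is scaled, so by homogeneity the scalar leaves \<open>A\<close>
  exactly once at every position.\<close>

lemma induced_smult:
  assumes A: "A \<in> continuous_multilinear I E F"
    and X: "\<And>r. r \<in> I \<Longrightarrow> sequence_class (X r)"
    and E: "\<And>r. r \<in> I \<Longrightarrow> banach_space (E r)"
    and x: "x \<in> tuples I (\<lambda>r. X r (E r))" and m: "m \<in> I"
  shows "induced I \<sigma> A (x(m := \<lambda>j. c \<odot>\<^bsub>E m\<^esub> x m j)) = (\<lambda>n. c \<odot>\<^bsub>F\<^esub> induced I \<sigma> A x n)"
proof
  fix n
  let ?v = "\<lambda>r\<in>I. x r (\<sigma> n r)"
  have v: "?v \<in> tuples I E"
    by (rule sequence_tuple_coordinates[OF X E x])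
  \<comment> \<open>Homogeneity is stated for updated tuples, so \<open>?v\<close> is viewed as an
    update of itself.\<close>
  have vm: "?v(m := x m (\<sigma> n m)) = ?v" and xm: "x m (\<sigma> n m) \<in> carrier (E m)"
    using m v by (auto simp: fun_eq_iff)
  have "(\<lambda>r\<in>I. (x(m := \<lambda>j. c \<odot>\<^bsub>E m\<^esub> x m j)) r (\<sigma> n r)) = ?v(m := c \<odot>\<^bsub>E m\<^esub> x m (\<sigma> n m))"
    using m by (auto simp: fun_eq_iff)
  moreover have "A (?v(m := c \<odot>\<^bsub>E m\<^esub> x m (\<sigma> n m))) = c \<odot>\<^bsub>F\<^esub> A (?v(m := x m (\<sigma> n m)))"
    using A v m xm unfolding continuous_multilinear_def by blast
  ultimately show "induced I \<sigma> A (x(m := \<lambda>j. c \<odot>\<^bsub>E m\<^esub> x m j)) n = c \<odot>\<^bsub>F\<^esub> induced I \<sigma> A x n"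
    by (simp add: induced_def vm)
qed

section \<open>Membership and norm estimate after fixing a variable\<close>

theorem proposition4p2:
  fixes d m :: nat
    and \<sigma> :: "nat \<Rightarrow> nat \<Rightarrow> nat"
    and X :: "nat \<Rightarrow> ('k::{real_normed_field,banach}, 'u) seq_rule"
    and Y :: "('k, 'u) seq_rule"
    and E :: "nat \<Rightarrow> ('k, 'k + 'u) normed_vs"
    and F :: "('k, 'k + 'u) normed_vs"
    and a :: "'k + 'u"
    and A :: "(nat \<Rightarrow> 'k + 'u) \<Rightarrow> 'k + 'u"
  assumes "2 \<le> d"
    and "bij_betw \<sigma> UNIV ({1..d} \<rightarrow>\<^sub>E UNIV)"
    and "\<And>r. r \<in> {1..d} \<Longrightarrow> sequence_class (X r)"
    and "sequence_class Y" and "zero_invariant Y"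
    and "m \<in> {1..d}"
    and "\<And>r. r \<in> {1..d} \<Longrightarrow> banach_space (E r)"
    and "banach_space F"
    and "a \<in> carrier (E m)"
    and "A \<in> summing_ops {1..d} \<sigma> X Y E F"
  shows "fix_var {1..d} E m a A
           \<in> summing_ops ({1..d} - {m}) (omit_enum {1..d} m \<sigma>) X Y E F \<and>
         (vnorm (X m (E m)) (single_seq (E m) 0 a) = vnorm (E m) a \<longrightarrow>
          summing_norm ({1..d} - {m}) (omit_enum {1..d} m \<sigma>) X Y E F (fix_var {1..d} E m a A)
            \<le> summing_norm {1..d} \<sigma> X Y E F A * ennreal (vnorm (E m) a))"
proof -
  let ?I = "{1..d}"
  let ?J = "{1..d} - {m}"
  let ?s = "omit_enum ?I m \<sigma>"
  let ?N = "{n. \<sigma> n m = 0}"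
  let ?B = "fix_var ?I E m a A"
  let ?S = "single_seq (E m) 0 a"
  note X = assms(3) and Y = assms(4) and zero_inv = assms(5) and m = assms(6)
    and E = assms(7) and F = assms(8) and a = assms(9)
  have A: "A \<in> continuous_multilinear ?I E F"
    and A_ind: "\<And>x. x \<in> tuples ?I (\<lambda>r. X r (E r)) \<Longrightarrow> induced ?I \<sigma> A x \<in> carrier (Y F)"
    using assms(10) by (auto simp: summing_ops_def)
  have N: "infinite ?N"
  proof -
    \<comment> \<open>Since \<open>d\<close> is at least 2, there is an index other than
      \<open>m\<close>.\<close>
    define r where "r = (if m = 1 then 2 else 1::nat)"
    have "r \<in> ?I" "r \<noteq> m" using assms(1) by (auto simp: r_def)
    then show ?thesis using infinite_fiber[OF assms(2) m] by blast
  qed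
  have S: "?S \<in> carrier (X m (E m))"
    by (rule single_seq_in_sequence_class[OF X[OF m] E[OF m] a])
  have upd: "x(m := ?S) \<in> tuples ?I (\<lambda>r. X r (E r))"
    if "x \<in> tuples ?J (\<lambda>r. X r (E r))" for x
    using m that S by (rule fun_upd_tuples)
  have "induced ?J ?s ?B x \<in> carrier (Y F) \<and>
      vnorm (Y F) (induced ?J ?s ?B x) = vnorm (Y F) (induced ?I \<sigma> A (x(m := ?S)))"
    if x: "x \<in> tuples ?J (\<lambda>r. X r (E r))" for x
  proof -
    let ?y = "induced ?I \<sigma> A (x(m := ?S))"
    have y: "?y \<in> carrier (Y F)"
      by (rule A_ind[OF upd[OF x]])
    have y_F: "?y n \<in> carrier F" for n
      by (rule sequence_class_carrier_closed[OF Y F y])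
    have B_eq: "induced ?J ?s ?B x = (\<lambda>k. ?y (enumerate ?N k))"
      by (rule induced_fix_var[where X = X and E = E and m = m and \<sigma> = \<sigma>, OF m X E x N])
    \<comment> \<open>Off \<open>?N\<close> the m-th argument of \<open>A\<close> is one of the
      zeros of \<open>?S\<close>.\<close>
    have "?y n = \<zero>\<^bsub>F\<^esub>" if "n \<notin> ?N" for n
      using that
      by (intro induced_eq_zero[
          where X = X and E = E and m = m and \<sigma> = \<sigma>,
          OF A F X E upd[OF x] m])
        (auto simp: single_seq_def)
    then have "nonzero_part F (induced ?J ?s ?B x) = nonzero_part F ?y"
      unfolding B_eq by (rule nonzero_part_compose_enumerate[OF N])
    moreover have "\<forall>k. induced ?J ?s ?B x k \<in> carrier F"
      unfolding B_eq using y_F by blast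
    \<comment> \<open>0-invariance is used twice: from \<open>?y\<close> to the common nonzero part,
      and from there back to the sequence of \<open>?B\<close>.\<close>
    ultimately show ?thesis
      using zero_inv F y y_F unfolding zero_invariant_def by metis
  qed
  note B_ind = conjunct1[OF this] and B_norm = conjunct2[OF this]
  have mem: "?B \<in> summing_ops ?J ?s X Y E F"
    using fix_var_continuous_multilinear[OF A m a E] B_ind by (simp add: summing_ops_def)
  \<comment> \<open>\<open>sequence_class\<close> normalizes unit sequences only over the scalar
    field. \<open>S_norm\<close> is what makes division by the norm of \<open>a\<close> bring
    \<open>?S\<close> into the unit ball.\<close>
  have "ennreal (vnorm (Y F) (induced ?J ?s ?B x))
      \<le> summing_norm ?I \<sigma> X Y E F A * ennreal (vnorm (E m) a)"
    if S_norm: "vnorm (X m (E m)) ?S = vnorm (E m) a"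
      and x: "x \<in> tuples ?J (\<lambda>r. X r (E r))"
      and x1: "\<forall>r\<in>?J. vnorm (X r (E r)) (x r) \<le> 1" for x
  proof (cases "a = \<zero>\<^bsub>E m\<^esub>")
    \<comment> \<open>Here no rescaling is possible, but the induced sequence vanishes and the left
      side is 0.\<close>
    case True
    then have "induced ?I \<sigma> A (x(m := ?S)) = (\<lambda>n. \<zero>\<^bsub>F\<^esub>)"
      by (intro ext induced_eq_zero[
          where X = X and E = E and m = m and \<sigma> = \<sigma>,
          OF A F X E upd[OF x] m])
        (auto simp: single_seq_def)
    then show ?thesis
      unfolding B_norm[OF x] by (simp add: sequence_class_vnorm_zero[OF Y F])
  next
    case False
    \<comment> \<open>This factor gives the multiple of \<open>?S\<close> norm exactly 1; the other
      variables already lie in their unit balls by \<open>x1\<close>.\<close>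
    define c :: 'k where "c = of_real (1 / vnorm (E m) a)"
    have pos: "vnorm (E m) a > 0"
      using E[OF m] a False by (metis banach_space_def less_eq_real_def)
    let ?y = "induced ?I \<sigma> A (x(m := ?S))"
    let ?x = "x(m := \<lambda>j. c \<odot>\<^bsub>E m\<^esub> ?S j)"
    have norm_c: "norm c = 1 / vnorm (E m) a"
      using pos by (simp add: c_def norm_divide)
    have "?x \<in> tuples ?I (\<lambda>r. X r (E r))"
      using m x sequence_class_smult(1)[OF X[OF m] E[OF m] S] by (rule fun_upd_tuples)
    moreover have "\<forall>r\<in>?I. vnorm (X r (E r)) (?x r) \<le> 1"
      using x1 sequence_class_smult(2)[OF X[OF m] E[OF m] S, of c] pos
      by (auto simp: S_norm norm_c)
    ultimately have "ennreal (vnorm (Y F) (induced ?I \<sigma> A ?x)) \<le> summing_norm ?I \<sigma> X Y E F A"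
      unfolding summing_norm_def by (intro SUP_upper) blast
    moreover have "vnorm (Y F) (induced ?I \<sigma> A ?x) = norm c * vnorm (Y F) ?y"
      using induced_smult[where X = X and E = E and m = m and \<sigma> = \<sigma>, OF A X E upd[OF x] m, of c]
        sequence_class_smult(2)[OF Y F A_ind[OF upd[OF x]], of c] by simp
    \<comment> \<open>Undoing the scaling produces the factor \<open>vnorm (E m) a\<close> of the
      estimate.\<close>
    then have "vnorm (Y F) ?y = vnorm (Y F) (induced ?I \<sigma> A ?x) * vnorm (E m) a"
      using pos by (simp add: norm_c)
    then have "ennreal (vnorm (Y F) ?y) =
        ennreal (vnorm (Y F) (induced ?I \<sigma> A ?x)) * ennreal (vnorm (E m) a)"
      using pos by (simp add: ennreal_mult'')
    ultimately show ?thesis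
      unfolding B_norm[OF x] by (simp add: mult_right_mono)
  qed
  then have "vnorm (X m (E m)) ?S = vnorm (E m) a \<Longrightarrow>
      summing_norm ?J ?s X Y E F ?B \<le> summing_norm ?I \<sigma> X Y E F A * ennreal (vnorm (E m) a)"
    unfolding summing_norm_def[of ?J] by (intro SUP_least) blast
  with mem show ?thesis by blast
qed

end
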